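(* Let $f(x)=g(Ex)$ on $\mathbb{R}^n$, where $E\in\mathbb{R}^{m\times n}$ is non-zero and $g:\mathbb{R}^m\to\mathbb{R}$ is continuously differentiable and strictly convex, with $\nabla g$ Lipschitz continuous with parameter $L>0$ on $\mathbb{R}^m$. Assume that the set $\mathcal{X}$ of minimizers of $f$ is non-empty, and let $f_{\min}=\min_{x\in\mathbb{R}^n} f(x)$. Put $L_f=L\|E\|^2$. Fix a (deterministic) $x^0\in\mathbb{R}^n$; for a (possibly random) error sequence $\{e^k\}_{k\ge1}$ in $\mathbb{R}^n$ let $$x^{k+1}=x^k-\tfrac{1}{L_f}\left(\nabla f(x^k)+e^{k+1}\right),\qquad k\ge0.$$ Suppose that scenario (S1) or scenario (S2) (see context) holds. Let $\{B_k\}_{k\ge1}$ be a sequence of non-negative numbers. (a) (Sublinear convergence) Suppose that for some $\rho>0$, $\|e^k\|_2^2\le B_k=O(1/k^{1+\rho})$ for all $k\ge1$. Then the sequence of iterates $\{x^k\}_{k\ge0}$ satisfies, for all $k\ge0$, $$f(x^{k+1})-f_{\min}\le O\left(\frac{1}{(k+1)^{1+\rho}}\right),$$ $$\|x^k-x^{k+1}\|_2\le O\left(\frac{1}{(k+1)^{(1+\rho)/2}}\right),\qquad \mathrm{dist}(x^k,\mathcal{X})\le O\left(\frac{1}{(k+1)^{(1+\rho)/2}}\right).$$ In particular, the sequence $\{f(x^k)\}_{k\ge0}$ converges at least sublinearly to $f_{\min}$, and the sequence $\{x^k\}_{k\ge0}$ converges at least sublinearly to an element in $\mathcal{X}$.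 (b) (Linear convergence) Suppose that for some $\rho\in(0,1)$, $\|e^k\|_2^2\le B_k=O(\rho^k)$ for all $k\ge1$. Then there exists a $c\in(0,1)$ such that the sequence of iterates $\{x^k\}_{k\ge0}$ satisfies, for all $k\ge0$, $$f(x^{k+1})-f_{\min}\le O\left(c^{2(k+1)}\right),\qquad \|x^k-x^{k+1}\|_2\le O(c^k),\qquad \mathrm{dist}(x^k,\mathcal{X})\le O(c^k).$$ In particular, the sequence $\{f(x^k)\}_{k\ge0}$ converges at least linearly to $f_{\min}$, and the sequence $\{x^k\}_{k\ge0}$ converges at least linearly to an element in $\mathcal{X}$.
   Context: $\|E\|=\sup_{\|x\|_2=1}\|Ex\|_2$ is the spectral norm; $\mathrm{dist}(x,\mathcal{X})=\min_{y\in\mathcal{X}}\|x-y\|_2$. Since $g$ is strictly convex, $Ex^*$ is the same vector $t^*\in\mathbb{R}^m$ for all $x^*\in\mathcal{X}$; for $B>0$ let $\mathcal{S}_B=\{y\in\mathbb{R}^m:\|y-t^*\|_2\le B\}$. A differentiable $g$ is strongly convex on a set $S$ if there is $\sigma>0$ with $g(y)-g(z)\ge(y-z)^T\nabla g(z)+\sigma\|y-z\|_2^2$ for all $y,z\in S$. Scenario (S1): $g$ is strongly convex on $\mathbb{R}^m$. Scenario (S2): $g$ is strongly convex on $\mathcal{S}_B$ for all $B\in(0,\infty)$, and the (possibly random) error sequence satisfies $\sum_{k=1}^\infty\|e^k\|_2^2\le\Gamma$ for some $\Gamma\in(0,\infty)$. The notation $O(h(k))$ denotes a quantity bounded by a constant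 times $h(k)$ for all indices $k$ under consideration.
   Formalization: In (a), convergence of the iterates x^k to an element of X is claimed only if ρ>1 or E is injective (it fails otherwise, e.g. for errors in ker E that are not summable); for all ρ>0 it is instead stated that dist(x^k,X) converges at least sublinearly to 0. *)

theory Defs
  imports "HOL-Probability.Probability"
begin

definition grad :: "('a::real_inner \<Rightarrow> real) \<Rightarrow> 'a \<Rightarrow> 'a" where
  "grad f x = (THE D. GDERIV f x :> D)"

definition strictly_convex :: "('a::real_vector \<Rightarrow> real) \<Rightarrow> bool" where
  "strictly_convex f \<longleftrightarrow>
     (\<forall>x y. \<forall>t\<in>{0<..<1}. x \<noteq> y \<longrightarrow>
        f ((1 - t) *\<^sub>R x + t *\<^sub>R y) < (1 - t) * f x + t * f y)"

(* The modulus is normalised without the usual factor 1/2. *)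
definition strongly_convex_on :: "'a::real_inner set \<Rightarrow> ('a \<Rightarrow> real) \<Rightarrow> bool" where
  "strongly_convex_on S g \<longleftrightarrow>
     (\<exists>\<sigma>>0. \<forall>y\<in>S. \<forall>z\<in>S. g y - g z \<ge> (y - z) \<bullet> grad g z + \<sigma> * (norm (y - z))\<^sup>2)"

definition minimizers :: "('a \<Rightarrow> real) \<Rightarrow> 'a set" where
  "minimizers f = {x. \<forall>y. f x \<le> f y}"

definition spectral_norm :: "real^'n^'m \<Rightarrow> real" where
  "spectral_norm E = onorm ((*v) E)"

(* The vector t* with E x = t* for all minimizers x of g(E x). It is well defined when g is
   strictly convex and a minimizer exists, which are standing assumptions wherever it is used. *)
definition optimal_image :: "(real^'m \<Rightarrow> real) \<Rightarrow> real^'n^'m \<Rightarrow> real^'m" where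
  "optimal_image g E = (THE t. \<forall>x\<in>minimizers (\<lambda>x. g (E *v x)). E *v x = t)"

definition scenario_S1 :: "(real^'m \<Rightarrow> real) \<Rightarrow> bool" where
  "scenario_S1 g \<longleftrightarrow> strongly_convex_on UNIV g"

(* The bound Gamma is deterministic and holds almost surely; the errors are indexed from 1. *)
definition scenario_S2 ::
  "'w measure \<Rightarrow> (real^'m \<Rightarrow> real) \<Rightarrow> real^'n^'m \<Rightarrow> (nat \<Rightarrow> 'w \<Rightarrow> real^'n) \<Rightarrow> bool" where
  "scenario_S2 M g E e \<longleftrightarrow>
     (\<forall>B>0. strongly_convex_on (cball (optimal_image g E) B) g) \<and>
     (\<exists>\<Gamma>>0. AE \<omega> in M. summable (\<lambda>k. (norm (e (Suc k) \<omega>))\<^sup>2) \<and>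
        (\<Sum>k. (norm (e (Suc k) \<omega>))\<^sup>2) \<le> \<Gamma>)"

(* "At least": the distance to the limit is bounded by such a rate (R-convergence), for all
   indices and not just eventually. *)
definition sublinear_convergence :: "(nat \<Rightarrow> 'a::metric_space) \<Rightarrow> 'a \<Rightarrow> bool" where
  "sublinear_convergence u l \<longleftrightarrow>
     (\<exists>C. \<exists>p>0. \<forall>k. dist (u k) l \<le> C * (1 / real (k + 1) powr p))"

definition linear_convergence :: "(nat \<Rightarrow> 'a::metric_space) \<Rightarrow> 'a \<Rightarrow> bool" where
  "linear_convergence u l \<longleftrightarrow>
     (\<exists>C. \<exists>c\<in>{0<..<1}. \<forall>k. dist (u k) l \<le> C * c ^ k)"

end

(*
  Inexact gradient descent decreases f - fmin by |grad f|^2 / (2 Lf) up to the error term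
  |e|^2 / (2 Lf). The squared errors are summable, so all iterates stay in one sublevel set, whose
  image under E is bounded, and g is strongly convex on a ball containing this image; in this way
  scenarios (S1) and (S2) are treated alike. A bounded right inverse of E moves every point x to a
  minimizer at distance at most a constant times |E x - t*|; with strong convexity this yields the
  Polyak-Lojasiewicz inequality and the quadratic growth of f on the sublevel set, although f
  itself need not be strongly convex. Hence f - fmin contracts up to the error and inherits any
  rate of the errors that decays slower than the contraction. The iterates converge where the
  step lengths are summable, and their limit is a minimizer because dist(x^k, X) tends to 0.
*)
theory Submission
  imports Defs
begin

section \<open>Scalar recurrences and convergence from telescoping bounds\<close>

text \<open>By induction \<open>a\<close> inherits the rate \<open>h\<close> of its perturbation,
  because the contraction \<open>q\<close> beats the decay of \<open>h\<close> by the margin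
  \<open>1 - r\<close>. The decay condition starts at \<open>N\<close>, since a polynomial rate may
  drop too fast at first. The constant precedes \<open>a\<close>, so that later one constant serves
  almost all outcomes.\<close>

lemma recurrence_rate:
  fixes h :: "nat \<Rightarrow> real"
  assumes q: "0 < q" and r: "r < 1" and h: "\<And>k. 0 < h k"
    and step: "\<And>k. k \<ge> N \<Longrightarrow> q * h k \<le> r * h (Suc k)"
  shows "\<exists>C\<ge>0. \<forall>a. (\<forall>k. a k \<le> c) \<longrightarrow> (\<forall>k. a (Suc k) \<le> q * a k + K * h k)
           \<longrightarrow> (\<forall>k. a k \<le> C * h k)"
proof -
  have r0: "0 < r"
  proof -
    have "0 < r * h (Suc N)"
      using step[of N] mult_pos_pos[OF q h[of N]] by simp
    then show ?thesis using h[of "Suc N"] by (simp add: zero_less_mult_iff)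
  qed
  define m where "m = Min (h ` {..N})"
  have m: "0 < m" "\<And>k. k \<le> N \<Longrightarrow> m \<le> h k"
    using h unfolding m_def by (auto simp: Min_gr_iff intro!: Min_le)
  \<comment> \<open>The first term covers the indices up to \<open>N\<close>, where \<open>h\<close>
    is at least \<open>m\<close>. The second is what the induction step needs:
    \<open>C * r + \<bar>K\<bar> * (r / q) \<le> C\<close>.\<close>
  define C where "C = max (\<bar>c\<bar> / m) (\<bar>K\<bar> * (r / q) / (1 - r))"
  have C0: "0 \<le> C"
    using m unfolding C_def by (simp add: le_max_iff_disj)
  have Cc: "\<bar>c\<bar> \<le> C * m"
    using pos_divide_le_eq[OF m(1), of "\<bar>c\<bar>" C] by (simp add: C_def)
  have CK: "\<bar>K\<bar> * (r / q) \<le> C * (1 - r)"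
    using r pos_divide_le_eq[of "1 - r" "\<bar>K\<bar> * (r / q)" C] by (simp add: C_def)
  have "a k \<le> C * h k" if a: "\<forall>k. a k \<le> c" "\<forall>k. a (Suc k) \<le> q * a k + K * h k" for a k
  proof -
    have small: "a k \<le> C * h k" if "k \<le> N" for k
    proof -
      have "a k \<le> \<bar>c\<bar>" using a(1) by (smt (verit))
      also have "\<dots> \<le> C * m" by (rule Cc)
      also have "\<dots> \<le> C * h k" using m(2)[OF that] C0 by (rule mult_left_mono)
      finally show ?thesis .
    qed
    show ?thesis
    proof (induction k)
      case 0
      then show ?case by (simp add: small)
    next
      case (Suc k)
      show ?case
      proof (cases "Suc k \<le> N")
        case True
        then show ?thesis by (rule small)
      next
        case False
        then have s: "q * h k \<le> r * h (Suc k)" by (intro step) simp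
        then have s': "h k \<le> (r / q) * h (Suc k)" using q by (simp add: field_simps)
        have "a (Suc k) \<le> q * a k + K * h k" using a by simp
        also have "\<dots> \<le> C * (q * h k) + \<bar>K\<bar> * h k"
        proof (rule add_mono)
          show "q * a k \<le> C * (q * h k)"
            using mult_left_mono[OF Suc.IH, of q] q by (simp add: mult.left_commute)
          show "K * h k \<le> \<bar>K\<bar> * h k"
            using h[of k] by (intro mult_right_mono) auto
        qed
        also have "\<dots> \<le> C * (r * h (Suc k)) + \<bar>K\<bar> * ((r / q) * h (Suc k))"
          by (intro add_mono mult_left_mono s s' C0) auto
        also have "\<dots> = (C * r + \<bar>K\<bar> * (r / q)) * h (Suc k)" by (simp add: algebra_simps)
        also have "\<dots> \<le> C * h (Suc k)"
          using CK h[of "Suc k"] by (intro mult_right_mono) (simp_all add: algebra_simps)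
        finally show ?thesis .
      qed
    qed
  qed
  then show ?thesis using C0 by (intro exI[of _ C] conjI allI impI)
qed

text \<open>\<open>D k\<close> acts as a bound on the path length that remains after index
  \<open>k\<close>. It decreases to 0 and so is non-negative; the triangle inequality then keeps all
  later points within \<open>D k\<close> of \<open>x k\<close>, which gives the Cauchy property and,
  in the limit, the rate.\<close>

lemma convergent_if_telescoping_bound:
  fixes x :: "nat \<Rightarrow> 'a::complete_space"
  assumes step: "\<And>k. dist (x k) (x (Suc k)) \<le> D k - D (Suc k)" and D: "D \<longlonglongrightarrow> 0"
  obtains l where "x \<longlonglongrightarrow> l" "\<And>k. dist (x k) l \<le> D k"
proof -
  have "decseq D"
    using step by (intro decseq_SucI) (smt (verit) zero_le_dist)
  then have D0: "0 \<le> D k" for k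
    using D by (rule decseq_ge)
  have tel: "dist (x k) (x (k + n)) \<le> D k - D (k + n)" for k n
  proof (induction n)
    case (Suc n)
    have "dist (x k) (x (k + Suc n)) \<le> dist (x k) (x (k + n)) + dist (x (k + n)) (x (Suc (k + n)))"
      using dist_triangle by simp
    then show ?case using Suc.IH step[of "k + n"] by simp
  qed simp
  have le: "dist (x k) (x n) \<le> D k" if "k \<le> n" for k n
    using tel[of k "n - k"] D0[of n] that by simp
  have "Cauchy x"
  proof (rule metric_CauchyI)
    fix \<epsilon> :: real
    assume "0 < \<epsilon>"
    then obtain N where N: "D N < \<epsilon> / 2"
      using order_tendstoD(2)[OF D, of "\<epsilon> / 2"] by (auto simp: eventually_sequentially)
    have "dist (x m) (x n) < \<epsilon>" if "m \<ge> N" "n \<ge> N" for m n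
      using le[OF that(1)] le[OF that(2)] N dist_triangle_half_r[of "x N" "x m" \<epsilon> "x n"] by simp
    then show "\<exists>N. \<forall>m\<ge>N. \<forall>n\<ge>N. dist (x m) (x n) < \<epsilon>" by blast
  qed
  then obtain l where l: "x \<longlonglongrightarrow> l"
    using Cauchy_convergent convergent_def by blast
  have "dist (x k) l \<le> D k" for k
  proof (rule tendsto_upperbound)
    show "(\<lambda>n. dist (x k) (x n)) \<longlonglongrightarrow> dist (x k) l" by (intro tendsto_intros l)
    show "\<forall>\<^sub>F n in sequentially. dist (x k) (x n) \<le> D k"
      using le by (auto simp: eventually_sequentially)
  qed simp
  with l show ?thesis by (rule that)
qed

text \<open>Integral comparison through the mean value theorem for \<open>u powr (1 - s)\<close>
  between \<open>k + 1\<close> and \<open>k + 2\<close>. The factor \<open>2 powr s\<close> comes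
  from \<open>z < k + 2 \<le> 2 * (k + 1)\<close>. This makes polynomial step bounds
  telescope.\<close>

lemma powr_telescoping_bound:
  fixes s :: real
  assumes "1 < s"
  shows "1 / real (k + 1) powr s
    \<le> 2 powr s / (s - 1) * (1 / real (k + 1) powr (s - 1) - 1 / real (k + 2) powr (s - 1))"
proof -
  have der: "((\<lambda>u. u powr (1 - s)) has_real_derivative (1 - s) * u powr (1 - s - 1)) (at u)"
    if "real (k + 1) \<le> u" for u
    using that by (auto intro!: derivative_eq_intros)
  obtain z where z: "real (k + 1) < z" "z < real (k + 2)"
    and eq: "real (k + 2) powr (1 - s) - real (k + 1) powr (1 - s)
      = (real (k + 2) - real (k + 1)) * ((1 - s) * z powr (1 - s - 1))"
    using MVT2[of "real (k + 1)" "real (k + 2)" "\<lambda>u. u powr (1 - s)", OF _ der] by auto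
  have pw: "1 / real n powr (s - 1) = real n powr (1 - s)" for n
    by (metis inverse_eq_divide minus_diff_eq powr_minus)
  have "1 / real (k + 1) powr s = 2 powr s * (1 / (2 * real (k + 1)) powr s)"
    by (subst powr_mult) simp_all
  also have "\<dots> \<le> 2 powr s * (1 / z powr s)"
    using assms z by (intro mult_left_mono divide_left_mono powr_mono2) (auto simp: powr_gt_zero)
  also have "\<dots> = 2 powr s * z powr (- s)" by (simp add: powr_minus inverse_eq_divide)
  also have "\<dots> = 2 powr s / (s - 1) * (real (k + 1) powr (1 - s) - real (k + 2) powr (1 - s))"
  proof -
    have "real (k + 1) powr (1 - s) - real (k + 2) powr (1 - s) = (s - 1) * z powr (- s)"
      using eq by (simp add: algebra_simps)
    then show ?thesis using assms by simp
  qed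
  finally show ?thesis unfolding pw .
qed

section \<open>Gradients, the descent lemma and strict convexity\<close>

lemma gderiv_imp_grad_eq:
  assumes D: "GDERIV f x :> D"
  shows "grad f x = D"
  unfolding grad_def
proof (rule the_equality[where P = "\<lambda>D. GDERIV f x :> D", OF D])
  fix D' assume "GDERIV f x :> D'"
  then have "(\<lambda>v. v \<bullet> D') = (\<lambda>v. v \<bullet> D)"
    using D unfolding gderiv_def by (rule has_derivative_unique)
  then show "D' = D" by (auto simp: fun_eq_iff vector_eq_ldot)
qed

lemma differentiable_imp_gderiv_grad:
  fixes g :: "'a::euclidean_space \<Rightarrow> real"
  assumes "g differentiable (at y)"
  shows "GDERIV g y :> grad g y"
proof -
  obtain g' where g': "(g has_derivative g') (at y)"
    using assms by (auto simp: differentiable_def)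
  interpret bounded_linear g' using g' by (rule has_derivative_bounded_linear)
  have "g' = (\<lambda>v. v \<bullet> adjoint g' 1)"
    using adjoint_works[OF linear_axioms, of _ 1] by (simp add: fun_eq_iff)
  then have D: "GDERIV g y :> adjoint g' 1"
    using g' unfolding gderiv_def by metis
  show ?thesis
    using D gderiv_imp_grad_eq[OF D] by simp
qed

text \<open>The descent lemma. Up to a constant, \<open>\<phi>\<close> is the difference of the two
  sides along the ray in direction \<open>d\<close>; by Cauchy-Schwarz and the Lipschitz bound its
  derivative is at most 0 for \<open>u \<ge> 0\<close>. Monotonicity thus replaces integration of
  the gradient.\<close>

lemma lipschitz_grad_upper_bound:
  fixes g :: "'a::euclidean_space \<Rightarrow> real"
  assumes D: "\<And>y. GDERIV g y :> grad g y" and lip: "L-lipschitz_on UNIV (grad g)"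
  shows "g (y + d) \<le> g y + d \<bullet> grad g y + L / 2 * (norm d)\<^sup>2"
proof -
  define \<phi> where "\<phi> u = g (y + u *\<^sub>R d) - u * (d \<bullet> grad g y) - L / 2 * u\<^sup>2 * (norm d)\<^sup>2" for u
  have "\<exists>c. DERIV \<phi> u :> c \<and> c \<le> 0" if u: "0 \<le> u" for u
  proof (intro exI conjI)
    have "((\<lambda>u. g (y + u *\<^sub>R d)) has_derivative (\<lambda>h. (h *\<^sub>R d) \<bullet> grad g (y + u *\<^sub>R d))) (at u)"
      using D[of "y + u *\<^sub>R d"] unfolding gderiv_def
      by (rule has_derivative_compose[rotated]) (auto intro!: derivative_eq_intros)
    then have "DERIV (\<lambda>u. g (y + u *\<^sub>R d)) u :> d \<bullet> grad g (y + u *\<^sub>R d)"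
      by (simp add: has_field_derivative_def mult_commute_abs)
    then show "DERIV \<phi> u :> d \<bullet> grad g (y + u *\<^sub>R d) - d \<bullet> grad g y - L * u * (norm d)\<^sup>2"
      unfolding \<phi>_def by (auto intro!: derivative_eq_intros)
    have "d \<bullet> grad g (y + u *\<^sub>R d) - d \<bullet> grad g y \<le> norm d * norm (grad g (y + u *\<^sub>R d) - grad g y)"
      by (metis inner_diff_right norm_cauchy_schwarz)
    also have "\<dots> \<le> norm d * (L * norm (u *\<^sub>R d))"
      using lipschitz_on_normD[OF lip, of "y + u *\<^sub>R d" y] by (intro mult_left_mono) auto
    also have "\<dots> = L * u * (norm d)\<^sup>2"
      using u by (simp add: power2_eq_square)
    finally show "d \<bullet> grad g (y + u *\<^sub>R d) - d \<bullet> grad g y - L * u * (norm d)\<^sup>2 \<le> 0"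
      by simp
  qed
  then have "\<phi> 1 \<le> \<phi> 0"
    using DERIV_nonpos_imp_nonincreasing[of 0 1 \<phi>] zero_le_one by blast
  then show ?thesis by (simp add: \<phi>_def)
qed

text \<open>If the images differed, the midpoint of \<open>x\<close> and \<open>y\<close> would have
  a value strictly below the minimum.\<close>

lemma strictly_convex_minimizers_image:
  assumes linear: "linear A" and convex: "strictly_convex g"
    and x: "x \<in> minimizers (\<lambda>x. g (A x))" and y: "y \<in> minimizers (\<lambda>x. g (A x))"
  shows "A x = A y"
proof (rule ccontr)
  assume "A x \<noteq> A y"
  then have "g ((1 - 1/2) *\<^sub>R A x + (1/2) *\<^sub>R A y) < (1 - 1/2) * g (A x) + (1/2) * g (A y)"
    using convex[unfolded strictly_convex_def, rule_format, of "1/2" "A x" "A y"] by simp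
  also have "\<dots> \<le> g (A y)"
    using x by (auto simp: minimizers_def dest: spec[of _ y])
  also have "\<dots> \<le> g (A ((1 - 1/2) *\<^sub>R x + (1/2) *\<^sub>R y))"
    using y by (simp add: minimizers_def)
  finally show False
    by (simp add: linear_add[OF linear] linear_scale[OF linear])
qed

section \<open>The composite function and its gradient steps\<close>

text \<open>A deterministic setting with one chosen minimizer \<open>xs\<close>, so that
  \<open>A xs\<close> is the vector t*. The assumption \<open>strong\<close> is the common
  consequence of both scenarios.\<close>

locale composite_minimization =
  fixes A :: "'a::euclidean_space \<Rightarrow> 'b::euclidean_space" and g :: "'b \<Rightarrow> real"
    and L :: real and xs :: 'a
  assumes linear: "linear A" and nonzero: "\<exists>x. A x \<noteq> 0" and L: "0 < L"
    and gderiv: "\<And>y. GDERIV g y :> grad g y"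
    and lipschitz: "L-lipschitz_on UNIV (grad g)"
    and convex: "strictly_convex g"
    and minimizer: "\<And>x. g (A xs) \<le> g (A x)"
    and strong: "\<And>R. 0 < R \<Longrightarrow> strongly_convex_on (cball (A xs) R) g"
begin

definition Lf where "Lf = L * (onorm A)\<^sup>2"
definition gap where "gap x = g (A x) - g (A xs)"
definition gradf where "gradf x = adjoint A (grad g (A x))"
abbreviation X where "X \<equiv> minimizers (\<lambda>x. g (A x))"

lemma bounded_linear: "bounded_linear A"
  using linear by (rule linear_conv_bounded_linear[THEN iffD1])

lemma Lf_pos: "0 < Lf"
  using L onorm_pos_lt[OF bounded_linear] nonzero by (simp add: Lf_def)

lemma gap_nonneg: "0 \<le> gap x"
  using minimizer by (simp add: gap_def)

lemma inner_gradf: "d \<bullet> gradf x = A d \<bullet> grad g (A x)"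
  unfolding gradf_def by (rule adjoint_works[OF linear])

lemma gderiv_composite: "GDERIV (\<lambda>x. g (A x)) x :> gradf x"
proof -
  have "((\<lambda>x. g (A x)) has_derivative (\<lambda>h. A h \<bullet> grad g (A x))) (at x)"
    using bounded_linear_imp_has_derivative[OF bounded_linear] gderiv[unfolded gderiv_def]
    by (rule has_derivative_compose)
  then show ?thesis by (simp add: gderiv_def inner_gradf)
qed

text \<open>The descent lemma for \<open>g\<close> in direction \<open>A d\<close>; the estimate
  \<open>norm (A d) \<le> onorm A * norm d\<close> turns \<open>L\<close> into
  \<open>Lf\<close>.\<close>

lemma gap_upper_bound: "gap (x + d) \<le> gap x + d \<bullet> gradf x + Lf / 2 * (norm d)\<^sup>2"
proof -
  have "g (A x + A d) \<le> g (A x) + A d \<bullet> grad g (A x) + L / 2 * (norm (A d))\<^sup>2"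
    using gderiv lipschitz by (rule lipschitz_grad_upper_bound)
  also have "\<dots> \<le> g (A x) + A d \<bullet> grad g (A x) + L / 2 * (onorm A * norm d)\<^sup>2"
    using L onorm[OF bounded_linear, of d] by (intro add_left_mono mult_left_mono power_mono) auto
  finally show ?thesis
    by (simp add: gap_def inner_gradf Lf_def power_mult_distrib linear_add[OF linear])
qed

text \<open>\<open>gap_upper_bound\<close> along the step. For step size \<open>1 / Lf\<close> the
  mixed terms \<open>v \<bullet> gradf x\<close> cancel, so the error enters only through its
  squared norm.\<close>

lemma gap_inexact_gradient_step:
  "gap (x - (1 / Lf) *\<^sub>R (gradf x + v)) \<le> gap x - (norm (gradf x))\<^sup>2 / (2 * Lf) + (norm v)\<^sup>2 / (2 * Lf)"
proof -
  define d where "d = - (1 / Lf) *\<^sub>R (gradf x + v)"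
  have "gap (x + d) \<le> gap x + d \<bullet> gradf x + Lf / 2 * (norm d)\<^sup>2"
    by (rule gap_upper_bound)
  also have "(norm d)\<^sup>2 = (norm (gradf x + v))\<^sup>2 / Lf\<^sup>2"
    using Lf_pos by (simp add: d_def power_divide)
  also have "d \<bullet> gradf x = - ((norm (gradf x))\<^sup>2 + v \<bullet> gradf x) / Lf"
    by (simp add: d_def inner_add_left power2_norm_eq_inner add_divide_distrib diff_divide_distrib)
  also have "(norm (gradf x + v))\<^sup>2 = (norm (gradf x))\<^sup>2 + 2 * (v \<bullet> gradf x) + (norm v)\<^sup>2"
    by (simp add: power2_norm_eq_inner inner_add_left inner_add_right inner_commute)
  also have "gap x + - (G + c) / Lf + Lf / 2 * ((G + 2 * c + V) / Lf\<^sup>2)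
      = gap x - G / (2 * Lf) + V / (2 * Lf)" for G c V
    using Lf_pos by (simp add: field_simps power2_eq_square)
  finally show ?thesis by (simp add: d_def)
qed

text \<open>An exact gradient step lowers the gap by at least
  \<open>(norm (gradf x))\<^sup>2 / (2 * Lf)\<close> and cannot take it below 0.\<close>

lemma gradf_norm_bound: "(norm (gradf x))\<^sup>2 \<le> 2 * Lf * gap x"
  using gap_inexact_gradient_step[of x 0] mult_nonneg_nonneg[OF less_imp_le[OF Lf_pos] gap_nonneg[of "x - (1 / Lf) *\<^sub>R gradf x"]] Lf_pos
  by (simp add: field_simps)

lemma gradf_minimizer: "gradf xs = 0"
  using gradf_norm_bound[of xs] by (simp add: gap_def)

lemma minimizers_eq: "X = {x. A x = A xs}"
proof -
  have "xs \<in> X" using minimizer by (simp add: minimizers_def)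
  then have "A x = A xs" if "x \<in> X" for x
    using strictly_convex_minimizers_image[OF linear convex that] by simp
  then show ?thesis using minimizer by (auto simp: minimizers_def)
qed

lemma closed_minimizers: "closed X"
  unfolding minimizers_eq
  by (intro closed_Collect_eq continuous_on_const linear_continuous_on bounded_linear)

section \<open>Error bounds on sublevel sets\<close>

text \<open>A Hoffman-type bound. \<open>G\<close> inverts \<open>A\<close> on its range, so
  \<open>x + G (A (xs - x))\<close> has image \<open>A xs\<close> and is a minimizer, and the shift
  is bounded by \<open>onorm G\<close> times the residual.\<close>

lemma minimizer_near:
  obtains \<tau> where "0 < \<tau>" "\<And>x. \<exists>y\<in>X. \<tau> * norm (y - x) \<le> norm (A x - A xs)"
proof -
  obtain G where G: "linear G" "\<And>v. A (G (A v)) = A v"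
    using linear_exists_right_inverse_on[OF linear subspace_UNIV] by auto
  define \<tau> where "\<tau> = 1 / (onorm G + 1)"
  have oG: "0 \<le> onorm G" "\<And>v. norm (G v) \<le> onorm G * norm v"
    using G(1) by (simp_all add: onorm onorm_pos_le linear_conv_bounded_linear)
  have "\<exists>y\<in>X. \<tau> * norm (y - x) \<le> norm (A x - A xs)" for x
  proof
    let ?w = "G (A (xs - x))"
    have "norm ?w \<le> (onorm G + 1) * norm (A (xs - x))"
      using oG(2)[of "A (xs - x)"] by (simp add: algebra_simps add_increasing)
    then show "\<tau> * norm ((x + ?w) - x) \<le> norm (A x - A xs)"
      using oG(1) by (simp add: \<tau>_def field_simps linear_diff[OF linear] norm_minus_commute)
    show "x + ?w \<in> X"
      by (simp add: minimizers_eq linear_add[OF linear] G(2)) (simp add: linear_diff[OF linear])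
  qed
  moreover have "0 < \<tau>" using oG(1) by (simp add: \<tau>_def)
  ultimately show ?thesis by (rule that[rotated])
qed

text \<open>Strong convexity on the unit ball makes the gap at least \<open>\<sigma>\<close> where
  the image has distance 1 from \<open>A xs\<close>; by convexity the gap then grows at least
  linearly in that distance. Hence the radius \<open>c / \<sigma>\<close>.\<close>

lemma sublevel_image_bounded:
  obtains R where "0 < R" "\<And>x. gap x \<le> c \<Longrightarrow> A x \<in> cball (A xs) R"
proof -
  obtain \<sigma> where \<sigma>: "0 < \<sigma>" and sc: "\<And>y z. y \<in> cball (A xs) 1 \<Longrightarrow> z \<in> cball (A xs) 1
      \<Longrightarrow> g y - g z \<ge> (y - z) \<bullet> grad g z + \<sigma> * (norm (y - z))\<^sup>2"
    using strong[of 1] unfolding strongly_convex_on_def by auto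
  have "A x \<in> cball (A xs) (max 1 (c / \<sigma>))" if c: "gap x \<le> c" for x
  proof (cases "norm (A x - A xs) \<le> 1")
    case True
    then show ?thesis by (simp add: dist_norm norm_minus_commute)
  next
    case False
    define r where "r = norm (A x - A xs)"
    have r: "1 < r" using False by (simp add: r_def)
    \<comment> \<open>The point of the segment from \<open>xs\<close> to \<open>x\<close> whose
      image has distance exactly 1 from \<open>A xs\<close>.\<close>
    define y where "y = (1 - 1 / r) *\<^sub>R xs + (1 / r) *\<^sub>R x"
    have Ay: "A y = (1 - 1 / r) *\<^sub>R A xs + (1 / r) *\<^sub>R A x"
      by (simp add: y_def linear_add[OF linear] linear_scale[OF linear])
    then have diff: "A y - A xs = (1 / r) *\<^sub>R (A x - A xs)"
      by (simp add: algebra_simps)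
    then have n1: "norm (A y - A xs) = 1"
      using r by (auto simp: r_def)
    \<comment> \<open>\<open>grad g (A xs)\<close> itself need not vanish; it is only orthogonal to
      the range of \<open>A\<close>.\<close>
    have "(A y - A xs) \<bullet> grad g (A xs) = 0"
      using inner_gradf[of "y - xs" xs] by (simp add: gradf_minimizer linear_diff[OF linear])
    then have "\<sigma> \<le> g (A y) - g (A xs)"
      using sc[of "A y" "A xs"] n1 by (simp add: dist_norm norm_minus_commute)
    moreover have "g (A y) < (1 - 1 / r) * g (A xs) + (1 / r) * g (A x)"
      using convex[unfolded strictly_convex_def, rule_format, of "1 / r" "A xs" "A x"] r
      unfolding Ay by (cases "A xs = A x") (auto simp: r_def)
    ultimately have "\<sigma> < (1 / r) * gap x"
      by (simp add: gap_def algebra_simps)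
    then have "\<sigma> * r \<le> c"
      using r c by (simp add: field_simps)
    then show ?thesis
      using \<sigma> by (simp add: r_def dist_norm norm_minus_commute field_simps le_max_iff_disj)
  qed
  moreover have "0 < max 1 (c / \<sigma>)" by (simp add: less_max_iff_disj)
  ultimately show ?thesis using that by blast
qed

text \<open>The Polyak-Lojasiewicz inequality and quadratic growth. Both apply strong convexity to
  the pair \<open>A x\<close>, \<open>A xs\<close>, linearizing at \<open>A x\<close> for the first
  and at \<open>A xs\<close> for the second.\<close>

lemma sublevel_error_bounds:
  obtains \<kappa> where "0 < \<kappa>" "\<And>x. gap x \<le> c \<Longrightarrow> \<kappa> * gap x \<le> (norm (gradf x))\<^sup>2"
    "\<And>x. gap x \<le> c \<Longrightarrow> \<kappa> * (infdist x X)\<^sup>2 \<le> gap x"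
proof -
  obtain R where R: "0 < R" "\<And>x. gap x \<le> c \<Longrightarrow> A x \<in> cball (A xs) R"
    using sublevel_image_bounded[of c] by blast
  obtain \<sigma> where \<sigma>: "0 < \<sigma>" and sc: "\<And>y z. y \<in> cball (A xs) R \<Longrightarrow> z \<in> cball (A xs) R
      \<Longrightarrow> g y - g z \<ge> (y - z) \<bullet> grad g z + \<sigma> * (norm (y - z))\<^sup>2"
    using strong[OF R(1)] unfolding strongly_convex_on_def by auto
  obtain \<tau> where \<tau>: "0 < \<tau>" "\<And>x. \<exists>y\<in>X. \<tau> * norm (y - x) \<le> norm (A x - A xs)"
    using minimizer_near by blast
  define s where "s = \<sigma> * \<tau>\<^sup>2"
  have s: "0 < s" using \<sigma> \<tau> by (simp add: s_def)
  have main: "4 * s * gap x \<le> (norm (gradf x))\<^sup>2 \<and> s * (infdist x X)\<^sup>2 \<le> gap x"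
    if c: "gap x \<le> c" for x
  proof -
    obtain y where y: "y \<in> X" "\<tau> * norm (y - x) \<le> norm (A x - A xs)"
      using \<tau>(2) by blast
    have Ay: "A y = A xs" using y(1) by (simp add: minimizers_eq)
    define n where "n = norm (y - x)"
    have sn: "s * n\<^sup>2 \<le> \<sigma> * (norm (A x - A xs))\<^sup>2"
      using power_mono[OF y(2), of 2] \<tau>(1) \<sigma> by (simp add: s_def n_def power_mult_distrib)
    \<comment> \<open>The nearby minimizer \<open>y\<close> may replace \<open>xs\<close>, as their
      images agree. The length of \<open>y - x\<close> is controlled by the residual, whereas
      \<open>xs - x\<close> may have a large component in the kernel of \<open>A\<close>.\<close>
    have "(A xs - A x) \<bullet> grad g (A x) = (y - x) \<bullet> gradf x"
      by (simp add: inner_gradf linear_diff[OF linear] Ay)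
    moreover have "- (n * norm (gradf x)) \<le> (y - x) \<bullet> gradf x"
      unfolding n_def using Cauchy_Schwarz_ineq2[of "y - x" "gradf x"] by linarith
    ultimately have "- (n * norm (gradf x)) + s * n\<^sup>2 \<le> - gap x"
      using sc[of "A xs" "A x"] R(2)[OF c] R(1) sn by (simp add: gap_def norm_minus_commute)
    \<comment> \<open>Multiplied by \<open>4 * s\<close>, the bound can be completed to a square,
      which removes the unknown \<open>n\<close>.\<close>
    then have "4 * s * gap x \<le> 4 * s * (n * norm (gradf x) - s * n\<^sup>2)"
      using s by (intro mult_left_mono) auto
    also have "\<dots> = (norm (gradf x))\<^sup>2 - (2 * s * n - norm (gradf x))\<^sup>2"
      by (simp add: power2_eq_square algebra_simps)
    also have "\<dots> \<le> (norm (gradf x))\<^sup>2" by simp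
    finally have 1: "4 * s * gap x \<le> (norm (gradf x))\<^sup>2" .
    have "(A x - A xs) \<bullet> grad g (A xs) = 0"
      using inner_gradf[of "x - xs" xs] by (simp add: gradf_minimizer linear_diff[OF linear])
    then have "s * n\<^sup>2 \<le> gap x"
      using sc[of "A x" "A xs"] R(2)[OF c] R(1) sn by (simp add: gap_def)
    moreover have "s * (infdist x X)\<^sup>2 \<le> s * n\<^sup>2"
      using infdist_le[OF y(1), of x] s
      by (intro mult_left_mono power_mono) (auto simp: n_def dist_norm norm_minus_commute infdist_nonneg)
    ultimately show ?thesis using 1 by simp
  qed
  show ?thesis
  proof (rule that[OF s])
    show "s * gap x \<le> (norm (gradf x))\<^sup>2" if "gap x \<le> c" for x
      using main[OF that] s mult_nonneg_nonneg[of s "gap x"] gap_nonneg[of x] by linarith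
  qed (use main in blast)
qed

section \<open>Inexact gradient iterates\<close>

text \<open>One realisation of the random iteration. Only the bounds \<open>b\<close> on the errors
  are kept, so that constants obtained from \<open>x0\<close> and \<open>b\<close> hold for all
  outcomes alike.\<close>

definition inexact_iterates where
  "inexact_iterates x0 b x \<longleftrightarrow> x 0 = x0 \<and>
     (\<forall>k. \<exists>v. (norm v)\<^sup>2 \<le> b k \<and> x (Suc k) = x k - (1 / Lf) *\<^sub>R (gradf (x k) + v))"

text \<open>The step inequality is summed without its gradient term. This puts the iterates of all
  realisations into one sublevel set.\<close>

lemma inexact_iterates_gap_bounded:
  assumes it: "inexact_iterates x0 b x" and b: "summable b"
  shows "gap (x k) \<le> gap x0 + suminf b / (2 * Lf)"
proof -
  have b0: "0 \<le> b k" for k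
    using it unfolding inexact_iterates_def by (meson order_trans zero_le_power2)
  have "gap (x k) \<le> gap x0 + (\<Sum>i<k. b i) / (2 * Lf)"
  proof (induction k)
    case 0
    then show ?case using it by (simp add: inexact_iterates_def)
  next
    case (Suc k)
    obtain v where v: "(norm v)\<^sup>2 \<le> b k" "x (Suc k) = x k - (1 / Lf) *\<^sub>R (gradf (x k) + v)"
      using it unfolding inexact_iterates_def by blast
    have "gap (x (Suc k)) \<le> gap (x k) - (norm (gradf (x k)))\<^sup>2 / (2 * Lf) + (norm v)\<^sup>2 / (2 * Lf)"
      unfolding v(2) by (rule gap_inexact_gradient_step)
    also have "\<dots> \<le> gap (x k) + b k / (2 * Lf)"
    proof -
      have "(norm v)\<^sup>2 / (2 * Lf) \<le> b k / (2 * Lf)"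
        using v(1) Lf_pos by (intro divide_right_mono) auto
      moreover have "0 \<le> (norm (gradf (x k)))\<^sup>2 / (2 * Lf)" using Lf_pos by simp
      ultimately show ?thesis by linarith
    qed
    finally show ?case using Suc.IH by (simp add: add_divide_distrib)
  qed
  also have "\<dots> \<le> gap x0 + suminf b / (2 * Lf)"
    using b b0 Lf_pos by (intro add_left_mono divide_right_mono sum_le_suminf) auto
  finally show ?thesis .
qed

text \<open>
  The contraction factor depends only on the starting point and on the errors, not on the
  comparison sequence \<open>h\<close>; a geometric \<open>h\<close> can therefore be chosen to decay slower than it.
\<close>
lemma inexact_iterates_rates:
  assumes b: "summable b"
  obtains q where "0 < q" "q < 1"
    "\<And>h r N K. \<lbrakk>r < 1; \<And>k. 0 < h k; \<And>k. k \<ge> N \<Longrightarrow> q * h k \<le> r * h (Suc k); \<And>k. b k \<le> K * h k\<rbrakk>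
      \<Longrightarrow> \<exists>C\<ge>0. \<forall>x. inexact_iterates x0 b x \<longrightarrow> (\<forall>k. gap (x k) \<le> C * h k
           \<and> norm (x k - x (Suc k)) \<le> C * sqrt (h k) \<and> infdist (x k) X \<le> C * sqrt (h k))"
proof -
  define c where "c = gap x0 + suminf b / (2 * Lf)"
  obtain \<kappa> where \<kappa>: "0 < \<kappa>" "\<And>x. gap x \<le> c \<Longrightarrow> \<kappa> * gap x \<le> (norm (gradf x))\<^sup>2"
    "\<And>x. gap x \<le> c \<Longrightarrow> \<kappa> * (infdist x X)\<^sup>2 \<le> gap x"
    using sublevel_error_bounds[of c] by blast
  \<comment> \<open>\<open>1 - \<kappa> / (2 * Lf)\<close> is the contraction that the
    Polyak-Lojasiewicz inequality gives; the maximum with \<open>1 / 2\<close> secures the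
    positivity that \<open>recurrence_rate\<close> requires.\<close>
  define q where "q = max (1 / 2) (1 - \<kappa> / (2 * Lf))"
  have q: "0 < q" "q < 1" using \<kappa>(1) Lf_pos by (auto simp: q_def less_max_iff_disj)
  have contr: "gap (x (Suc k)) \<le> q * gap (x k) + b k / (2 * Lf)"
    if it: "inexact_iterates x0 b x" for x k
  proof -
    obtain v where v: "(norm v)\<^sup>2 \<le> b k" "x (Suc k) = x k - (1 / Lf) *\<^sub>R (gradf (x k) + v)"
      using it unfolding inexact_iterates_def by blast
    have "\<kappa> * gap (x k) \<le> (norm (gradf (x k)))\<^sup>2"
      using \<kappa>(2) inexact_iterates_gap_bounded[OF it b] by (simp add: c_def)
    then have "\<kappa> * gap (x k) / (2 * Lf) \<le> (norm (gradf (x k)))\<^sup>2 / (2 * Lf)"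
      using Lf_pos by (intro divide_right_mono) auto
    moreover have "(norm v)\<^sup>2 / (2 * Lf) \<le> b k / (2 * Lf)"
      using v(1) Lf_pos by (intro divide_right_mono) auto
    moreover have "(1 - \<kappa> / (2 * Lf)) * gap (x k) \<le> q * gap (x k)"
      using gap_nonneg by (intro mult_right_mono) (auto simp: q_def)
    moreover have "(1 - \<kappa> / (2 * Lf)) * gap (x k) = gap (x k) - \<kappa> * gap (x k) / (2 * Lf)"
      by (simp add: left_diff_distrib)
    ultimately show ?thesis
      using gap_inexact_gradient_step[of "x k" v] unfolding v(2) by linarith
  qed
  have "\<exists>C\<ge>0. \<forall>x. inexact_iterates x0 b x \<longrightarrow> (\<forall>k. gap (x k) \<le> C * h k
           \<and> norm (x k - x (Suc k)) \<le> C * sqrt (h k) \<and> infdist (x k) X \<le> C * sqrt (h k))"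
    if r: "r < 1" and h: "\<And>k. 0 < h k" and step: "\<And>k. k \<ge> N \<Longrightarrow> q * h k \<le> r * h (Suc k)"
      and bK: "\<And>k. b k \<le> K * h k" for h :: "nat \<Rightarrow> real" and r N K
  proof -
    obtain C1 where C1: "0 \<le> C1" and rec: "\<And>a k. \<lbrakk>\<And>k. a k \<le> c; \<And>k. a (Suc k) \<le> q * a k + K / (2 * Lf) * h k\<rbrakk>
        \<Longrightarrow> a k \<le> C1 * h k"
      using recurrence_rate[of q r h N c "K / (2 * Lf)", OF q(1) r h step] by auto
    \<comment> \<open>The summands serve, in this order, the gap, the distance to \<open>X\<close>
      and the step length; their sum dominates each.\<close>
    define C where "C = C1 + sqrt (C1 / \<kappa>) + (sqrt (2 * Lf * C1) + sqrt \<bar>K\<bar>) / Lf"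
    have nn: "0 \<le> sqrt (C1 / \<kappa>)" "0 \<le> (sqrt (2 * Lf * C1) + sqrt \<bar>K\<bar>) / Lf"
      using C1 \<kappa>(1) Lf_pos by auto
    have "gap (x k) \<le> C * h k \<and> norm (x k - x (Suc k)) \<le> C * sqrt (h k)
        \<and> infdist (x k) X \<le> C * sqrt (h k)" if it: "inexact_iterates x0 b x" for x k
    proof -
      have g1: "gap (x k) \<le> C1 * h k"
      proof (rule rec[of "\<lambda>k. gap (x k)"])
        fix k
        show "gap (x k) \<le> c"
          using inexact_iterates_gap_bounded[OF it b] by (simp add: c_def)
        have "b k / (2 * Lf) \<le> (K * h k) / (2 * Lf)"
          using bK Lf_pos by (intro divide_right_mono) auto
        then show "gap (x (Suc k)) \<le> q * gap (x k) + K / (2 * Lf) * h k"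
          using contr[OF it, of k] by simp
      qed
      have "\<kappa> * (infdist (x k) X)\<^sup>2 \<le> C1 * h k"
        using g1 \<kappa>(3)[of "x k"] inexact_iterates_gap_bounded[OF it b, of k] by (simp add: c_def)
      then have "(infdist (x k) X)\<^sup>2 \<le> (C1 / \<kappa>) * h k"
        using \<kappa>(1) by (simp add: field_simps)
      then have i1: "infdist (x k) X \<le> sqrt (C1 / \<kappa>) * sqrt (h k)"
        unfolding real_sqrt_mult[symmetric] by (rule real_le_rsqrt)
      obtain v where v: "(norm v)\<^sup>2 \<le> b k" "x (Suc k) = x k - (1 / Lf) *\<^sub>R (gradf (x k) + v)"
        using it unfolding inexact_iterates_def by blast
      have "(norm v)\<^sup>2 \<le> \<bar>K\<bar> * h k"
        using v(1) bK[of k] h[of k] mult_right_mono[OF abs_ge_self[of K], of "h k"] by linarith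
      then have nv: "norm v \<le> sqrt \<bar>K\<bar> * sqrt (h k)"
        unfolding real_sqrt_mult[symmetric] by (rule real_le_rsqrt)
      have "(norm (gradf (x k)))\<^sup>2 \<le> 2 * Lf * (C1 * h k)"
        using gradf_norm_bound[of "x k"] mult_left_mono[OF g1, of "2 * Lf"] Lf_pos by linarith
      then have ng: "norm (gradf (x k)) \<le> sqrt (2 * Lf * C1) * sqrt (h k)"
        unfolding real_sqrt_mult[symmetric] by (intro real_le_rsqrt) (simp add: mult.assoc)
      have "norm (x k - x (Suc k)) = norm (gradf (x k) + v) / Lf"
        using Lf_pos by (simp add: v(2))
      also have "\<dots> \<le> (sqrt (2 * Lf * C1) * sqrt (h k) + sqrt \<bar>K\<bar> * sqrt (h k)) / Lf"
        using ng nv norm_triangle_ineq[of "gradf (x k)" v] Lf_pos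
        by (intro divide_right_mono) auto
      finally have n1: "norm (x k - x (Suc k)) \<le> (sqrt (2 * Lf * C1) + sqrt \<bar>K\<bar>) / Lf * sqrt (h k)"
        by (simp add: distrib_right)
      have "C1 \<le> C" "sqrt (C1 / \<kappa>) \<le> C" "(sqrt (2 * Lf * C1) + sqrt \<bar>K\<bar>) / Lf \<le> C"
        unfolding C_def using C1 nn by linarith+
      then have "C1 * h k \<le> C * h k" "sqrt (C1 / \<kappa>) * sqrt (h k) \<le> C * sqrt (h k)"
        "(sqrt (2 * Lf * C1) + sqrt \<bar>K\<bar>) / Lf * sqrt (h k) \<le> C * sqrt (h k)"
        using h[of k] by (intro mult_right_mono; simp)+
      then show ?thesis using g1 i1 n1 by linarith
    qed
    moreover have "0 \<le> C" unfolding C_def using C1 nn by simp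
    ultimately show ?thesis by blast
  qed
  with q show ?thesis by (rule that)
qed

text \<open>The step bound yields a limit, and the distance to the closed set \<open>X\<close> is
  continuous and tends to 0. \<open>D\<close> bounds the remaining path and may decay more slowly
  than the distance bound \<open>D'\<close>.\<close>

lemma converges_to_minimizer:
  assumes step: "\<And>k. norm (x k - x (Suc k)) \<le> D k - D (Suc k)" and D: "D \<longlonglongrightarrow> 0"
    and near: "\<And>k. infdist (x k) X \<le> D' k" and D': "D' \<longlonglongrightarrow> 0"
  obtains l where "l \<in> X" "\<And>k. dist (x k) l \<le> D k"
proof -
  obtain l where l: "x \<longlonglongrightarrow> l" "\<And>k. dist (x k) l \<le> D k"
    using convergent_if_telescoping_bound[of x D] step D by (auto simp: dist_norm)
  have "(\<lambda>k. infdist (x k) X) \<longlonglongrightarrow> infdist l X"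
    using l(1) by (rule tendsto_infdist)
  moreover have "(\<lambda>k. infdist (x k) X) \<longlonglongrightarrow> 0"
    by (rule tendsto_sandwich[OF _ _ tendsto_const D']) (auto simp: near infdist_nonneg)
  ultimately have "infdist l X = 0" by (rule LIMSEQ_unique)
  moreover have "X \<noteq> {}" by (auto simp: minimizers_eq)
  ultimately have "l \<in> X"
    using in_closed_iff_infdist_zero[OF closed_minimizers] by blast
  then show ?thesis using l(2) by (rule that)
qed

end

section \<open>Polynomial rates\<close>

lemma sqrt_powr_rate: "sqrt (1 / real n powr p) = 1 / real n powr (p / 2)"
  by (simp add: real_sqrt_divide powr_half_sqrt[symmetric] powr_powr)

text \<open>The ratio of consecutive values is \<open>(1 + 1 / (k + 1)) powr p\<close> and tends to
  1, so it eventually falls below \<open>(1 + q) / 2 / q\<close>, which exceeds 1.\<close>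

lemma powr_rate_step:
  assumes "0 < q" "q < 1"
  obtains N where "\<And>k. k \<ge> N \<Longrightarrow> q * (1 / real (k + 1) powr p) \<le> (1 + q) / 2 * (1 / real (Suc k + 1) powr p)"
proof -
  have "(\<lambda>k. (1 + 1 / real (Suc k)) powr p) \<longlonglongrightarrow> (1 + 0) powr p"
    by (intro tendsto_intros LIMSEQ_Suc[OF lim_1_over_n]) auto
  moreover have "1 < (1 + q) / 2 / q" using assms by (simp add: field_simps)
  ultimately have "\<forall>\<^sub>F k in sequentially. (1 + 1 / real (Suc k)) powr p < (1 + q) / 2 / q"
    by (intro order_tendstoD(2)) auto
  then obtain N where N: "\<And>k. k \<ge> N \<Longrightarrow> (1 + 1 / real (Suc k)) powr p < (1 + q) / 2 / q"
    by (auto simp: eventually_sequentially)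
  have "q * (1 / real (k + 1) powr p) \<le> (1 + q) / 2 * (1 / real (Suc k + 1) powr p)" if "k \<ge> N" for k
  proof -
    have "1 + 1 / real (Suc k) = real (Suc k + 1) / real (k + 1)" by (simp add: field_simps)
    then have "real (Suc k + 1) powr p / real (k + 1) powr p \<le> (1 + q) / 2 / q"
      using N[OF that] by (simp add: powr_divide)
    moreover have "0 < real (Suc k + 1) powr p" "0 < real (k + 1) powr p" by simp_all
    ultimately show ?thesis using assms(1) by (simp add: divide_simps mult.commute)
  qed
  then show ?thesis by (rule that)
qed

lemma tendsto_powr_rate:
  assumes "0 < p"
  shows "(\<lambda>k. C * (1 / real (k + 1) powr p)) \<longlonglongrightarrow> 0"
proof -
  have "(\<lambda>k. real (Suc k) powr - p) \<longlonglongrightarrow> 0"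
    using assms by (intro LIMSEQ_Suc[OF tendsto_neg_powr] filterlim_real_sequentially) auto
  then show ?thesis
    using tendsto_mult_right_zero[of "\<lambda>k. real (Suc k) powr - p" sequentially C]
    by (simp add: powr_minus inverse_eq_divide)
qed

lemma summable_powr_rate:
  assumes "1 < p"
  shows "summable (\<lambda>k. K * (1 / real (k + 1) powr p))"
proof -
  have "summable (\<lambda>n. real (Suc n) powr - p)"
    using assms summable_real_powr_iff[of "- p"] summable_Suc_iff[of "\<lambda>n. real n powr - p"] by simp
  then show ?thesis by (intro summable_mult) (simp add: powr_minus inverse_eq_divide)
qed

section \<open>Convergence rates of the random iterates\<close>

text \<open>\<open>C\<close> stands before \<open>AE\<close>: the constants are deterministic, while
  the limit point may depend on the outcome. In the sublinear case a limit point is claimed for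
  \<open>\<rho> > 1\<close>, where the step bounds are summable, and for injective \<open>E\<close>,
  where \<open>X\<close> is a single point. Otherwise errors in the kernel of \<open>E\<close> with
  non-summable norms can make the iterates drift along \<open>X\<close> for ever, so convergence to
  \<open>X\<close> is stated for the distance.\<close>

theorem corollary3:
  fixes M :: "'w measure"
    and E :: "real^'n^'m"
    and g :: "real^'m \<Rightarrow> real"
    and f :: "real^'n \<Rightarrow> real"
    and L Lf fmin :: real
    and X :: "(real^'n) set"
    and x0 :: "real^'n"
    and e x :: "nat \<Rightarrow> 'w \<Rightarrow> real^'n"
    and B :: "nat \<Rightarrow> real"
  assumes "prob_space M"
    and "E \<noteq> 0"
    and "\<forall>y. g differentiable (at y)" and "continuous_on UNIV (grad g)"
    and "strictly_convex g"
    and "L > 0" and "L-lipschitz_on UNIV (grad g)"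
    and f_def: "f = (\<lambda>x. g (E *v x))"
    and X_def: "X = minimizers f" and "X \<noteq> {}"
    and fmin_def: "fmin = (INF y. f y)"
    and Lf_def: "Lf = L * (spectral_norm E)\<^sup>2"
    and "\<forall>k\<ge>1. e k \<in> borel_measurable M"
    and "\<forall>\<omega>\<in>space M. x 0 \<omega> = x0"
    and "\<forall>\<omega>\<in>space M. \<forall>k. x (k + 1) \<omega> = x k \<omega> - (1 / Lf) *\<^sub>R (grad f (x k \<omega>) + e (k + 1) \<omega>)"
    and "scenario_S1 g \<or> scenario_S2 M g E e"
    and "\<forall>k\<ge>1. B k \<ge> 0"
    and "AE \<omega> in M. \<forall>k\<ge>1. (norm (e k \<omega>))\<^sup>2 \<le> B k"
  shows
    "(\<forall>\<rho>>0. (\<exists>K. \<forall>k\<ge>1. B k \<le> K * (1 / real k powr (1 + \<rho>))) \<longrightarrow>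
        (\<exists>C. AE \<omega> in M. \<forall>k. f (x (k + 1) \<omega>) - fmin \<le> C * (1 / real (k + 1) powr (1 + \<rho>))) \<and>
        (\<exists>C. AE \<omega> in M. \<forall>k. norm (x k \<omega> - x (k + 1) \<omega>) \<le> C * (1 / real (k + 1) powr ((1 + \<rho>) / 2))) \<and>
        (\<exists>C. AE \<omega> in M. \<forall>k. infdist (x k \<omega>) X \<le> C * (1 / real (k + 1) powr ((1 + \<rho>) / 2))) \<and>
        (AE \<omega> in M. sublinear_convergence (\<lambda>k. f (x k \<omega>)) fmin) \<and>
        (AE \<omega> in M. sublinear_convergence (\<lambda>k. infdist (x k \<omega>) X) 0) \<and>
        (\<rho> > 1 \<or> inj ((*v) E) \<longrightarrow>
          (AE \<omega> in M. \<exists>xs\<in>X. sublinear_convergence (\<lambda>k. x k \<omega>) xs)))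
     \<and>
     (\<forall>\<rho>\<in>{0<..<1}. (\<exists>K. \<forall>k\<ge>1. B k \<le> K * \<rho> ^ k) \<longrightarrow>
        (\<exists>c\<in>{0<..<1}.
          (\<exists>C. AE \<omega> in M. \<forall>k. f (x (k + 1) \<omega>) - fmin \<le> C * c ^ (2 * (k + 1))) \<and>
          (\<exists>C. AE \<omega> in M. \<forall>k. norm (x k \<omega> - x (k + 1) \<omega>) \<le> C * c ^ k) \<and>
          (\<exists>C. AE \<omega> in M. \<forall>k. infdist (x k \<omega>) X \<le> C * c ^ k)) \<and>
        (AE \<omega> in M. linear_convergence (\<lambda>k. f (x k \<omega>)) fmin) \<and>
        (AE \<omega> in M. \<exists>xs\<in>X. linear_convergence (\<lambda>k. x k \<omega>) xs))"
proof -
  have linE: "linear ((*v) E)" by simp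
  obtain xs where xs: "xs \<in> X" using \<open>X \<noteq> {}\<close> by blast
  have gd: "GDERIV g y :> grad g y" for y
    using assms(3) by (simp add: differentiable_imp_gderiv_grad)
  have nz: "\<exists>x. E *v x \<noteq> 0"
    using \<open>E \<noteq> 0\<close> by (metis matrix_eq matrix_vector_mult_0)
  have min: "g (E *v xs) \<le> g (E *v x)" for x
    using xs by (simp add: X_def f_def minimizers_def)
  have strong: "strongly_convex_on (cball (E *v xs) R) g" if "0 < R" for R
    using assms(16)
  proof
    assume "scenario_S1 g"
    then show ?thesis unfolding scenario_S1_def strongly_convex_on_def by blast
  next
    assume S2: "scenario_S2 M g E e"
    \<comment> \<open>The balls of (S2) are centred at \<open>optimal_image g E\<close>; strict
      convexity identifies this centre with \<open>E *v xs\<close>.\<close>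
    have "optimal_image g E = E *v xs"
      unfolding optimal_image_def
    proof (rule the_equality)
      show "\<forall>x\<in>minimizers (\<lambda>x. g (E *v x)). E *v x = E *v xs"
        using strictly_convex_minimizers_image[OF linE assms(5)] xs unfolding X_def f_def by blast
      show "t = E *v xs" if "\<forall>x\<in>minimizers (\<lambda>x. g (E *v x)). E *v x = t" for t
        using that xs unfolding X_def f_def by metis
    qed
    then show ?thesis using S2 that unfolding scenario_S2_def by metis
  qed
  interpret cm: composite_minimization "(*v) E" g L xs
    using linE nz \<open>L > 0\<close> gd assms(7) assms(5) min strong
    by (rule composite_minimization.intro)
  have Lf: "Lf = cm.Lf" by (simp add: Lf_def cm.Lf_def spectral_norm_def)
  have X: "X = cm.X" by (simp add: X_def f_def)
  have "fmin = f xs"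
    unfolding fmin_def f_def using min by (intro cInf_eq_minimum) auto
  then have gap: "f z - fmin = cm.gap z" for z by (simp add: f_def cm.gap_def)
  have gradf: "grad f z = cm.gradf z" for z
    unfolding f_def by (rule gderiv_imp_grad_eq[OF cm.gderiv_composite])
  have dist_f: "dist (f z) fmin = cm.gap z" for z
    using gap[of z] cm.gap_nonneg[of z] by (simp add: dist_real_def)
  \<comment> \<open>The step from \<open>x k\<close> carries the error \<open>e (k + 1)\<close>, so
    the bounds are shifted by one.\<close>
  define b where "b k = B (Suc k)" for k
  have iter: "AE \<omega> in M. cm.inexact_iterates x0 b (\<lambda>k. x k \<omega>)"
    using assms(18) AE_space
  proof eventually_elim
    case (elim \<omega>)
    then show ?case
      using assms(14,15) unfolding cm.inexact_iterates_def b_def Lf gradf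
      by (intro conjI allI exI[of _ "e (Suc k) \<omega>" for k]) auto
  qed
  \<comment> \<open>Transfer to almost all outcomes, with \<open>C\<close> fixed before the outcome;
    \<open>s\<close> is the closed form of the square root of \<open>h\<close>.\<close>
  have rates: "\<exists>C\<ge>0. AE \<omega> in M. \<forall>k. cm.gap (x k \<omega>) \<le> C * h k
      \<and> norm (x k \<omega> - x (k + 1) \<omega>) \<le> C * s k \<and> infdist (x k \<omega>) X \<le> C * s k"
    if ex: "\<exists>C\<ge>0. \<forall>x. cm.inexact_iterates x0 b x \<longrightarrow> (\<forall>k. cm.gap (x k) \<le> C * h k
      \<and> norm (x k - x (Suc k)) \<le> C * sqrt (h k) \<and> infdist (x k) cm.X \<le> C * sqrt (h k))"
      and s: "\<And>k. sqrt (h k) = s k" for h s :: "nat \<Rightarrow> real"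
  proof -
    obtain C where C0: "0 \<le> C" and C: "\<forall>y. cm.inexact_iterates x0 b y \<longrightarrow> (\<forall>k. cm.gap (y k) \<le> C * h k
      \<and> norm (y k - y (Suc k)) \<le> C * s k \<and> infdist (y k) X \<le> C * s k)"
      using ex unfolding X s by (elim exE conjE)
    have "AE \<omega> in M. \<forall>k. cm.gap (x k \<omega>) \<le> C * h k
      \<and> norm (x k \<omega> - x (k + 1) \<omega>) \<le> C * s k \<and> infdist (x k \<omega>) X \<le> C * s k"
      using iter
    proof eventually_elim
      case (elim \<omega>)
      then show ?case using C[rule_format, OF elim] by simp
    qed
    with C0 show ?thesis by (intro exI[of _ C] conjI)
  qed
  show ?thesis
  proof (intro conjI allI impI ballI)
    fix \<rho> :: real
    assume "0 < \<rho>" and "\<exists>K. \<forall>k\<ge>1. B k \<le> K * (1 / real k powr (1 + \<rho>))"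
    then obtain K where K: "\<And>k. k \<ge> 1 \<Longrightarrow> B k \<le> K * (1 / real k powr (1 + \<rho>))" by blast
    define h where "h k = 1 / real (k + 1) powr (1 + \<rho>)" for k
    have bK: "b k \<le> K * h k" for k using K[of "Suc k"] by (simp add: b_def h_def)
    have "summable b"
    proof (rule summable_comparison_test'[OF summable_powr_rate])
      show "1 < 1 + \<rho>" using \<open>0 < \<rho>\<close> by simp
      show "norm (b k) \<le> K * (1 / real (k + 1) powr (1 + \<rho>))" if "0 \<le> k" for k
        using bK[of k] assms(17) by (simp add: b_def h_def)
    qed
    from cm.inexact_iterates_rates[OF this, of x0]
    obtain q where q: "0 < q" "q < 1"
      and qr: "\<And>h r N K. \<lbrakk>r < 1; \<And>k. 0 < h k; \<And>k. k \<ge> N \<Longrightarrow> q * h k \<le> r * h (Suc k); \<And>k. b k \<le> K * h k\<rbrakk>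
      \<Longrightarrow> \<exists>C\<ge>0. \<forall>x. cm.inexact_iterates x0 b x \<longrightarrow> (\<forall>k. cm.gap (x k) \<le> C * h k
           \<and> norm (x k - x (Suc k)) \<le> C * sqrt (h k) \<and> infdist (x k) cm.X \<le> C * sqrt (h k))"
      by blast
    obtain N where N: "\<And>k. k \<ge> N \<Longrightarrow> q * h k \<le> (1 + q) / 2 * h (Suc k)"
      using powr_rate_step[OF q, of "1 + \<rho>"] unfolding h_def by blast
    define s where "s k = 1 / real (k + 1) powr ((1 + \<rho>) / 2)" for k
    have "\<exists>C\<ge>0. AE \<omega> in M. \<forall>k. cm.gap (x k \<omega>) \<le> C * h k
      \<and> norm (x k \<omega> - x (k + 1) \<omega>) \<le> C * s k \<and> infdist (x k \<omega>) X \<le> C * s k"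
    proof (rule rates[OF qr])
      show "(1 + q) / 2 < 1" using q by simp
      show "0 < h k" for k by (simp add: h_def)
      show "q * h k \<le> (1 + q) / 2 * h (Suc k)" if "k \<ge> N" for k using that by (rule N)
      show "b k \<le> K * h k" for k by (rule bK)
      show "sqrt (h k) = s k" for k unfolding h_def s_def by (rule sqrt_powr_rate)
    qed
    then obtain C where C0: "0 \<le> C" and C: "AE \<omega> in M. \<forall>k. cm.gap (x k \<omega>) \<le> C * h k
      \<and> norm (x k \<omega> - x (k + 1) \<omega>) \<le> C * s k \<and> infdist (x k \<omega>) X \<le> C * s k" by blast
    \<comment> \<open>The rate at iterate \<open>k + 1\<close> is \<open>h (Suc k)\<close>, whereas
      the claim there is in terms of the larger \<open>h k\<close>.\<close>
    have hmono: "C * h (Suc k) \<le> C * h k" for k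
      unfolding h_def using \<open>0 < \<rho>\<close> C0
      by (intro mult_left_mono divide_left_mono powr_mono2) auto
    show "\<exists>C. AE \<omega> in M. \<forall>k. f (x (k + 1) \<omega>) - fmin \<le> C * (1 / real (k + 1) powr (1 + \<rho>))"
    proof (intro exI[of _ C], use C in eventually_elim, intro allI)
      fix \<omega> k
      assume *: "\<forall>k. cm.gap (x k \<omega>) \<le> C * h k
        \<and> norm (x k \<omega> - x (k + 1) \<omega>) \<le> C * s k \<and> infdist (x k \<omega>) X \<le> C * s k"
      have "cm.gap (x (k + 1) \<omega>) \<le> C * h k"
        using *[rule_format, of "Suc k"] hmono[of k] by simp
      then show "f (x (k + 1) \<omega>) - fmin \<le> C * (1 / real (k + 1) powr (1 + \<rho>))"
        by (simp add: gap h_def)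
    qed
    show "\<exists>C. AE \<omega> in M. \<forall>k. norm (x k \<omega> - x (k + 1) \<omega>) \<le> C * (1 / real (k + 1) powr ((1 + \<rho>) / 2))"
      by (intro exI[of _ C], use C in eventually_elim) (simp add: s_def)
    show "\<exists>C. AE \<omega> in M. \<forall>k. infdist (x k \<omega>) X \<le> C * (1 / real (k + 1) powr ((1 + \<rho>) / 2))"
      by (intro exI[of _ C], use C in eventually_elim) (simp add: s_def)
    show "AE \<omega> in M. sublinear_convergence (\<lambda>k. f (x k \<omega>)) fmin"
      using C
    proof eventually_elim
      case (elim \<omega>)
      then show ?case
        unfolding sublinear_convergence_def dist_f using \<open>0 < \<rho>\<close>
        by (intro exI[of _ C] exI[of _ "1 + \<rho>"]) (simp add: h_def)
    qed
    show "AE \<omega> in M. sublinear_convergence (\<lambda>k. infdist (x k \<omega>) X) 0"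
      using C
    proof eventually_elim
      case (elim \<omega>)
      then show ?case
        unfolding sublinear_convergence_def using \<open>0 < \<rho>\<close>
        by (intro exI[of _ C] exI[of _ "(1 + \<rho>) / 2"]) (simp add: s_def infdist_nonneg)
    qed
    assume "\<rho> > 1 \<or> inj ((*v) E)"
    then show "AE \<omega> in M. \<exists>xs\<in>X. sublinear_convergence (\<lambda>k. x k \<omega>) xs"
    proof
      assume "inj ((*v) E)"
      then have "X = {xs}"
        unfolding X cm.minimizers_eq by (auto dest: injD)
      show ?thesis
        using C
      proof eventually_elim
        case (elim \<omega>)
        then show ?case
          unfolding sublinear_convergence_def using \<open>0 < \<rho>\<close> \<open>X = {xs}\<close>
          by (intro bexI[of _ xs] exI[of _ C] exI[of _ "(1 + \<rho>) / 2"]) (simp_all add: s_def)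
      qed
    next
      assume "1 < \<rho>"
      then have p: "1 < (1 + \<rho>) / 2" by simp
      \<comment> \<open>Summing the tail of the step bounds costs one power of
        \<open>k\<close>.\<close>
      define p where "p = (1 + \<rho>) / 2 - 1"
      define C' where "C' = C * (2 powr ((1 + \<rho>) / 2) / p)"
      have p0: "0 < p" using \<open>1 < \<rho>\<close> by (simp add: p_def)
      have tel: "C * s k \<le> C' * (1 / real (k + 1) powr p) - C' * (1 / real (Suc k + 1) powr p)" for k
        using mult_left_mono[OF powr_telescoping_bound[OF p, of k] C0]
        by (simp add: s_def C'_def p_def right_diff_distrib mult.assoc)
      show ?thesis
        using C
      proof eventually_elim
        case (elim \<omega>)
        obtain l where "l \<in> X" "\<And>k. dist (x k \<omega>) l \<le> C' * (1 / real (k + 1) powr p)"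
        proof (rule cm.converges_to_minimizer[of "\<lambda>k. x k \<omega>" "\<lambda>k. C' * (1 / real (k + 1) powr p)"
              "\<lambda>k. C * s k"])
          show "norm (x k \<omega> - x (Suc k) \<omega>)
              \<le> C' * (1 / real (k + 1) powr p) - C' * (1 / real (Suc k + 1) powr p)" for k
            using elim tel[of k] by (metis Suc_eq_plus1 order_trans)
          show "(\<lambda>k. C' * (1 / real (k + 1) powr p)) \<longlonglongrightarrow> 0"
            using p0 by (rule tendsto_powr_rate)
          show "infdist (x k \<omega>) cm.X \<le> C * s k" for k using elim X by simp
          show "(\<lambda>k. C * s k) \<longlonglongrightarrow> 0"
            unfolding s_def using \<open>0 < \<rho>\<close> by (intro tendsto_powr_rate) simp
        qed (use X in auto)
        then show ?case
          using p0 unfolding sublinear_convergence_def by blast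
      qed
    qed
  next
    fix \<rho> :: real
    assume \<rho>: "\<rho> \<in> {0<..<1}" and "\<exists>K. \<forall>k\<ge>1. B k \<le> K * \<rho> ^ k"
    then obtain K where K: "\<And>k. k \<ge> 1 \<Longrightarrow> B k \<le> K * \<rho> ^ k" by blast
    \<comment> \<open>The factor \<open>\<rho>\<close> in the constant comes from the index shift in
      \<open>b\<close>.\<close>
    have bK: "b k \<le> (K * \<rho>) * \<rho> ^ k" for k using K[of "Suc k"] by (simp add: b_def mult.assoc)
    have "summable b"
    proof (rule summable_comparison_test'[OF summable_mult[OF summable_geometric]])
      show "norm \<rho> < 1" using \<rho> by simp
      show "norm (b k) \<le> (K * \<rho>) * \<rho> ^ k" if "0 \<le> k" for k
        using bK[of k] assms(17) by (simp add: b_def)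
    qed
    from cm.inexact_iterates_rates[OF this, of x0]
    obtain q where q: "0 < q" "q < 1"
      and qr: "\<And>h r N K. \<lbrakk>r < 1; \<And>k. 0 < h k; \<And>k. k \<ge> N \<Longrightarrow> q * h k \<le> r * h (Suc k); \<And>k. b k \<le> K * h k\<rbrakk>
      \<Longrightarrow> \<exists>C\<ge>0. \<forall>x. cm.inexact_iterates x0 b x \<longrightarrow> (\<forall>k. cm.gap (x k) \<le> C * h k
           \<and> norm (x k - x (Suc k)) \<le> C * sqrt (h k) \<and> infdist (x k) cm.X \<le> C * sqrt (h k))"
      by blast
    \<comment> \<open>The midpoint of \<open>max q \<rho>\<close> and 1: \<open>r ^ k\<close> then
      decays more slowly than the contraction and than the error bounds.\<close>
    define r where "r = (1 + max q \<rho>) / 2"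
    have r: "0 < r" "r < 1" "q < r" "\<rho> < r" using q \<rho> by (auto simp: r_def max_def)
    \<comment> \<open>The gap decays like \<open>r ^ k = c ^ (2 * k)\<close>, step lengths and
      distances like its square root \<open>c ^ k\<close>.\<close>
    define c where "c = sqrt r"
    have c: "c \<in> {0<..<1}" "r = c\<^sup>2" using r by (simp_all add: c_def)
    have "\<exists>C\<ge>0. AE \<omega> in M. \<forall>k. cm.gap (x k \<omega>) \<le> C * r ^ k
      \<and> norm (x k \<omega> - x (k + 1) \<omega>) \<le> C * c ^ k \<and> infdist (x k \<omega>) X \<le> C * c ^ k"
    proof (rule rates[OF qr])
      show "q / r < 1" "0 < r ^ k" for k using r q by simp_all
      show "q * r ^ k \<le> q / r * r ^ Suc k" if "0 \<le> k" for k using r by simp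
      show "b k \<le> \<bar>K * \<rho>\<bar> * r ^ k" for k
      proof -
        have "(K * \<rho>) * \<rho> ^ k \<le> \<bar>K * \<rho>\<bar> * r ^ k"
          using \<rho> r by (intro mult_mono power_mono) auto
        then show ?thesis using bK[of k] by linarith
      qed
      show "sqrt (r ^ k) = c ^ k" for k unfolding c_def by (rule real_sqrt_power)
    qed
    then obtain C where C0: "0 \<le> C" and C: "AE \<omega> in M. \<forall>k. cm.gap (x k \<omega>) \<le> C * r ^ k
      \<and> norm (x k \<omega> - x (k + 1) \<omega>) \<le> C * c ^ k \<and> infdist (x k \<omega>) X \<le> C * c ^ k" by blast
    have cpow: "(\<lambda>k. K * c ^ k) \<longlonglongrightarrow> 0" for K
      using c(1) by (intro tendsto_mult_right_zero LIMSEQ_realpow_zero) auto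
    show "\<exists>c\<in>{0<..<1}.
          (\<exists>C. AE \<omega> in M. \<forall>k. f (x (k + 1) \<omega>) - fmin \<le> C * c ^ (2 * (k + 1))) \<and>
          (\<exists>C. AE \<omega> in M. \<forall>k. norm (x k \<omega> - x (k + 1) \<omega>) \<le> C * c ^ k) \<and>
          (\<exists>C. AE \<omega> in M. \<forall>k. infdist (x k \<omega>) X \<le> C * c ^ k)"
    proof (intro bexI[OF _ c(1)] conjI exI[of _ C])
      show "AE \<omega> in M. \<forall>k. f (x (k + 1) \<omega>) - fmin \<le> C * c ^ (2 * (k + 1))"
        using C unfolding gap power_mult c(2)[symmetric] by eventually_elim blast
      show "AE \<omega> in M. \<forall>k. norm (x k \<omega> - x (k + 1) \<omega>) \<le> C * c ^ k"
        using C by eventually_elim blast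
      show "AE \<omega> in M. \<forall>k. infdist (x k \<omega>) X \<le> C * c ^ k"
        using C by eventually_elim blast
    qed
    show "AE \<omega> in M. linear_convergence (\<lambda>k. f (x k \<omega>)) fmin"
      using C
    proof eventually_elim
      case (elim \<omega>)
      then show ?case
        unfolding linear_convergence_def dist_f using r by (intro exI[of _ C] bexI[of _ r]) auto
    qed
    show "AE \<omega> in M. \<exists>xs\<in>X. linear_convergence (\<lambda>k. x k \<omega>) xs"
      using C
    proof eventually_elim
      case (elim \<omega>)
      \<comment> \<open>\<open>C / (1 - c) * c ^ k\<close> is the tail of the geometric series of
        step bounds.\<close>
      have tel: "C * c ^ k = C / (1 - c) * c ^ k - C / (1 - c) * c ^ Suc k" for k
      proof -
        have "C / (1 - c) * c ^ k - C / (1 - c) * c ^ Suc k = (C / (1 - c) * (1 - c)) * c ^ k"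
          by (simp only: power_Suc algebra_simps)
        also have "C / (1 - c) * (1 - c) = C" using c(1) by simp
        finally show ?thesis by simp
      qed
      obtain l where "l \<in> X" "\<And>k. dist (x k \<omega>) l \<le> C / (1 - c) * c ^ k"
      proof (rule cm.converges_to_minimizer[of "\<lambda>k. x k \<omega>" "\<lambda>k. C / (1 - c) * c ^ k" "\<lambda>k. C * c ^ k"])
        show "norm (x k \<omega> - x (Suc k) \<omega>) \<le> C / (1 - c) * c ^ k - C / (1 - c) * c ^ Suc k" for k
          using elim unfolding tel[symmetric] by simp
        show "infdist (x k \<omega>) cm.X \<le> C * c ^ k" for k using elim X by simp
        show "(\<lambda>k. C / (1 - c) * c ^ k) \<longlonglongrightarrow> 0" "(\<lambda>k. C * c ^ k) \<longlonglongrightarrow> 0" by (rule cpow)+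
      qed (use X in auto)
      then show ?case
        using c(1) unfolding linear_convergence_def by blast
    qed
  qed
qed

end
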